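(* In the setting described in the context, suppose that the semi-infinite characteristic cone constraint qualification holds, i.e. $\mathcal{C}_1+\mathcal{C}_2$ is closed. Then there exist $\mu^{\star}\in\mathcal{M}(\mathbf{Y})$ and $\eta^{\star}\in\mathbb{R}_+^s$ such that $$r^{\star}=\inf_{x\in\mathbb{R}^m}\left\{h(x)+\int_{\mathbf{Y}}p(x,y)\,d\mu^{\star}(y)+\sum_{j=1}^s\eta_j^{\star}\psi_j(x)\right\},$$ where $r^{\star}:=\inf_{x\in\mathbf{K}}h(x)$.
   Context: Let $\mathbf{Y}\subset\mathbb{R}^n$ be compact. Let $h,\psi_1,\dots,\psi_s:\mathbb{R}^m\to\mathbb{R}$, and $p(\cdot,y):\mathbb{R}^m\to\mathbb{R}$ for every $y\in\mathbf{Y}$, be continuous convex functions (not necessarily polynomials), where $p:\mathbb{R}^m\times\mathbb{R}^n\to\mathbb{R}$ is lower semicontinuous and $p(x,\cdot):\mathbb{R}^n\to\mathbb{R}$ is continuous for all $x\in\mathbb{R}^m$. Let $\mathbf{K}:=\{x\in\mathbb{R}^m:\psi_1(x)\le 0,\dots,\psi_s(x)\le 0,\ p(x,y)\le 0\ \forall y\in\mathbf{Y}\}$ and assume $\mathbf{K}\neq\emptyset$. $\mathcal{M}(\mathbf{Y})$ denotes the set of (finite) nonnegative Borel measures supported on $\mathbf{Y}$. For a function $\varphi$ on $\mathbb{R}^m$, $\varphi^*(\xi)=\sup_{x\in\mathbb{R}^m}\{\langle\xi,x\rangle-\varphi(x)\}$ is its conjugate and $\operatorname{epi}\varphi^*\subset\mathbb{R}^{m+1}$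 the epigraph of $\varphi^*$. Set $$\mathcal{C}_1:=\bigcup_{\mu\in\mathcal{M}(\mathbf{Y})}\operatorname{epi}\Big(\int_{\mathbf{Y}}p(\cdot,y)\,d\mu(y)\Big)^*,\qquad \mathcal{C}_2:=\bigcup_{\eta\in\mathbb{R}_+^s}\operatorname{epi}\Big(\sum_{j=1}^s\eta_j\psi_j\Big)^*.$$ *)

theory Defs
  imports "HOL-Analysis.Analysis"
begin

definition lower_semicontinuous :: "('a::topological_space \<Rightarrow> real) \<Rightarrow> bool" where
  "lower_semicontinuous f \<longleftrightarrow> (\<forall>z. \<forall>c<f z. \<forall>\<^sub>F w in nhds z. c < f w)"

definition conjugate :: "('a::real_inner \<Rightarrow> real) \<Rightarrow> 'a \<Rightarrow> ereal" where
  "conjugate \<phi> \<xi> = (SUP x. ereal (\<xi> \<bullet> x - \<phi> x))"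

text \<open>The library constant \<^const>\<open>epigraph\<close> is for real-valued functions only, whereas a
  conjugate may take the value \<open>\<infinity>\<close>; an epigraph contains only points with a real last coordinate.\<close>

definition epi :: "('a \<Rightarrow> ereal) \<Rightarrow> ('a \<times> real) set" where
  "epi f = {(\<xi>, r). f \<xi> \<le> ereal r}"

text \<open>Measures on \<open>Y\<close> are represented as Borel measures on the whole space that vanish
  outside \<open>Y\<close>, which for closed \<open>Y\<close> means that the support is contained in \<open>Y\<close>.\<close>

definition measures_on :: "'b::topological_space set \<Rightarrow> 'b measure set" where
  "measures_on Y = {\<mu>. sets \<mu> = sets borel \<and> finite_measure \<mu> \<and> emeasure \<mu> (- Y) = 0}"

text \<open>Vectors in \<open>\<real>\<^sup>s\<close> are functions on \<^typ>\<open>nat\<close> whose values at the indices \<open>1, \<dots>, s\<close> are the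
  coordinates; values elsewhere are irrelevant.\<close>

definition nonneg_orthant :: "nat \<Rightarrow> (nat \<Rightarrow> real) set" where
  "nonneg_orthant s = {1..s} \<rightarrow> {0..}"

definition feasible_set ::
  "nat \<Rightarrow> (nat \<Rightarrow> 'a \<Rightarrow> real) \<Rightarrow> ('a \<Rightarrow> 'b \<Rightarrow> real) \<Rightarrow> 'b set \<Rightarrow> 'a set" where
  "feasible_set s \<psi> p Y = {x. (\<forall>j\<in>{1..s}. \<psi> j x \<le> 0) \<and> (\<forall>y\<in>Y. p x y \<le> 0)}"

definition cone1 ::
  "('a::real_inner \<Rightarrow> 'b::topological_space \<Rightarrow> real) \<Rightarrow> 'b set \<Rightarrow> ('a \<times> real) set" where
  "cone1 p Y = (\<Union>\<mu>\<in>measures_on Y. epi (conjugate (\<lambda>x. LINT y:Y|\<mu>. p x y)))"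

definition cone2 :: "nat \<Rightarrow> (nat \<Rightarrow> 'a::real_inner \<Rightarrow> real) \<Rightarrow> ('a \<times> real) set" where
  "cone2 s \<psi> = (\<Union>\<eta>\<in>nonneg_orthant s. epi (conjugate (\<lambda>x. \<Sum>j=1..s. \<eta> j * \<psi> j x)))"

end

(* Let R be the (finite) infimum of h over K. Separating the strict epigraph of h from K \<times> {..R}
   gives an affine function b - a \<bullet> x below h with a \<bullet> x \<le> b - R on K. The closed convex cone
   C = C1 + C2 consists of pairs (\<xi>, t) with \<xi> \<bullet> x \<le> t on K, and it contains the conjugate
   epigraphs of all \<psi>_j and (by Dirac measures) of all p(_, y); so, by subgradients, a point v with
   \<xi> \<bullet> v \<le> t for all (\<xi>, t) in C lies in K. Farkas' lemma for C then yields (a, b - R) \<in> C,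
   which is a choice of multipliers. If the infimum is -\<infinity>, zero multipliers work. *)

theory Submission
  imports Defs "HOL-Probability.Giry_Monad"
begin

section \<open>Addition of two measures on a common sigma-algebra\<close>

definition sum_measure :: "'a measure \<Rightarrow> 'a measure \<Rightarrow> 'a measure" where
  "sum_measure M N = measure_of (space M) (sets M) (\<lambda>A. emeasure M A + emeasure N A)"

lemma space_sum_measure [simp]: "space (sum_measure M N) = space M"
  by (simp add: sum_measure_def sets.space_closed)

lemma sets_sum_measure [simp, measurable_cong]: "sets (sum_measure M N) = sets M"
  by (simp add: sum_measure_def)

text \<open>\<open>measure_of\<close> falls back to the value 0 unless its set function is countably
  additive, so this must be established before \<open>sum_measure\<close> takes the intended
  values.\<close>

lemma emeasure_sum_measure:
  assumes MN: "sets M = sets N" and A: "A \<in> sets M"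
  shows "emeasure (sum_measure M N) A = emeasure M A + emeasure N A"
proof -
  have "countably_additive (sets M) (\<lambda>A. emeasure M A + emeasure N A)"
  proof (rule countably_additiveI)
    fix A :: "nat \<Rightarrow> 'a set"
    assume A: "range A \<subseteq> sets M" "disjoint_family A"
    then show "(\<Sum>i. emeasure M (A i) + emeasure N (A i)) =
        emeasure M (\<Union>i. A i) + emeasure N (\<Union>i. A i)"
      by (subst suminf_add[symmetric]) (use MN in \<open>simp_all add: suminf_emeasure summableI\<close>)
  qed
  then show ?thesis
    unfolding sum_measure_def using A sets.sigma_algebra_axioms[of M]
    by (intro emeasure_measure_of_sigma) (simp_all add: positive_def)
qed

text \<open>Induction on the construction of \<open>f\<close>: indicators reduce to
  \<open>emeasure_sum_measure\<close>, and for increasing limits the two suprema can be added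
  because both sequences of integrals increase.\<close>

lemma nn_integral_sum_measure:
  assumes MN: "sets M = sets N" and f: "f \<in> borel_measurable M"
  shows "nn_integral (sum_measure M N) f = nn_integral M f + nn_integral N f"
  using f
proof (induction rule: borel_measurable_induct)
  case (cong f g)
  have "space M = space N" using MN by (rule sets_eq_imp_space_eq)
  then have "nn_integral L f = nn_integral L g" if "space L = space M" for L
    using cong.hyps that by (intro nn_integral_cong) auto
  with cong.IH \<open>space M = space N\<close> show ?case by simp
next
  case (set A)
  then show ?case using MN by (simp add: emeasure_sum_measure)
next
  case (mult u v)
  have [measurable]: "u \<in> borel_measurable M" "u \<in> borel_measurable N"
    using mult.hyps MN by (auto cong: measurable_cong_sets)
  show ?case using mult.IH by (simp add: nn_integral_cmult distrib_left)
next
  case (add u v)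
  have [measurable]: "u \<in> borel_measurable M" "u \<in> borel_measurable N"
      "v \<in> borel_measurable M" "v \<in> borel_measurable N"
    using add.hyps MN by (auto cong: measurable_cong_sets)
  show ?case using add.IH by (simp add: nn_integral_add ac_simps)
next
  case (seq U)
  have [measurable]: "U i \<in> borel_measurable M" "U i \<in> borel_measurable N" for i
    using seq.hyps MN by (auto cong: measurable_cong_sets)
  have sup: "nn_integral L (Sup (range U)) = (SUP i. nn_integral L (U i))"
    if "sets L = sets M" for L
  proof -
    have "U i \<in> borel_measurable L" for i
      using seq.hyps that by (auto cong: measurable_cong_sets)
    with nn_integral_monotone_convergence_SUP[OF \<open>incseq U\<close>] show ?thesis
      by (simp add: SUP_apply[abs_def] image_comp)
  qed
  have "incseq (\<lambda>i. nn_integral M (U i))" "incseq (\<lambda>i. nn_integral N (U i))"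
    using incseq_SucD[OF \<open>incseq U\<close>] by (auto intro!: incseq_SucI nn_integral_mono simp: le_fun_def)
  then have "(SUP i. nn_integral M (U i) + nn_integral N (U i)) =
      (SUP i. nn_integral M (U i)) + (SUP i. nn_integral N (U i))"
    by (rule ennreal_SUP_add)
  then show ?case
    by (simp only: sup[OF sets_sum_measure] sup[OF refl] sup[OF MN[symmetric]] seq.IH)
qed

text \<open>Positive and negative parts are treated separately as nonnegative integrals.
  Integrability keeps all four of them finite, which is what makes \<open>enn2real\<close> additive
  here.\<close>

lemma integral_sum_measure:
  fixes f :: "'a \<Rightarrow> real"
  assumes MN: "sets M = sets N" and M: "integrable M f" and N: "integrable N f"
  shows "integral\<^sup>L (sum_measure M N) f = integral\<^sup>L M f + integral\<^sup>L N f"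
proof -
  have [measurable]: "f \<in> borel_measurable M" using M by auto
  have "integrable (sum_measure M N) f"
    using M N MN by (auto simp: integrable_iff_bounded nn_integral_sum_measure)
  moreover have "(\<integral>\<^sup>+x. ennreal (f x) \<partial>M) < \<infinity>" "(\<integral>\<^sup>+x. ennreal (f x) \<partial>N) < \<infinity>"
      "(\<integral>\<^sup>+x. ennreal (- f x) \<partial>M) < \<infinity>" "(\<integral>\<^sup>+x. ennreal (- f x) \<partial>N) < \<infinity>"
    using M N by (auto simp: real_integrable_def less_top)
  ultimately show ?thesis
    using M N by (simp add: real_lebesgue_integral_def nn_integral_sum_measure MN enn2real_plus)
qed

section \<open>Finite measures carried by \<open>Y\<close>, and integration against them\<close>

lemma measures_onD:
  assumes "\<mu> \<in> measures_on Y"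
  shows "sets \<mu> = sets borel" "finite_measure \<mu>" "emeasure \<mu> (- Y) = 0"
  using assms by (auto simp: measures_on_def)

lemma sum_measure_in_measures_on:
  fixes Y :: "'b::topological_space set"
  assumes "closed Y" and \<mu>: "\<mu> \<in> measures_on Y" and \<nu>: "\<nu> \<in> measures_on Y"
  shows "sum_measure \<mu> \<nu> \<in> measures_on Y"
proof -
  have eq: "sets \<mu> = sets \<nu>" and "- Y \<in> sets \<mu>" "space \<mu> = space \<nu>"
    using measures_onD[OF \<mu>] measures_onD[OF \<nu>] \<open>closed Y\<close> sets_eq_imp_space_eq[of \<mu> \<nu>]
    by auto
  moreover have "emeasure (sum_measure \<mu> \<nu>) (space \<mu>) \<noteq> \<infinity>"
    using emeasure_sum_measure[OF eq sets.top]
      finite_measure.emeasure_finite[OF measures_onD(2)[OF \<mu>]]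
      finite_measure.emeasure_finite[OF measures_onD(2)[OF \<nu>]]
    by simp
  ultimately show ?thesis
    using measures_onD[OF \<mu>] measures_onD[OF \<nu>]
    by (auto simp: measures_on_def emeasure_sum_measure[OF eq] intro!: finite_measureI)
qed

lemma scale_measure_in_measures_on:
  assumes \<mu>: "\<mu> \<in> measures_on Y"
  shows "scale_measure (ennreal c) \<mu> \<in> measures_on Y"
  using measures_onD[OF \<mu>] finite_measure.emeasure_finite[of \<mu>]
  by (auto simp: measures_on_def space_scale_measure ennreal_mult_eq_top_iff intro!: finite_measureI)

lemma return_in_measures_on:
  fixes Y :: "'b::topological_space set"
  assumes "closed Y" "y \<in> Y"
  shows "return borel y \<in> measures_on Y"
proof -
  have "prob_space (return borel y)" by (simp add: prob_space_return)
  then show ?thesis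
    using assms by (auto simp: measures_on_def prob_space.finite_measure)
qed

lemma null_measure_in_measures_on: "null_measure borel \<in> measures_on Y"
  by (auto simp: measures_on_def intro!: finite_measureI)

text \<open>A scaled measure is a constant density. For non-measurable \<open>f\<close> both
  integrals have the default value 0, so no integrability is assumed.\<close>

lemma integral_scale_measure:
  fixes f :: "'a \<Rightarrow> real"
  assumes "0 \<le> c"
  shows "integral\<^sup>L (scale_measure (ennreal c) M) f = c * integral\<^sup>L M f"
proof (cases "f \<in> borel_measurable M")
  case True
  have "scale_measure (ennreal c) M = density M (\<lambda>_. ennreal c)"
    by (rule measure_eqI) (simp_all add: emeasure_density_const)
  with True assms show ?thesis
    by (simp add: integral_density)
next
  case False
  then have "\<not> integrable M f" "\<not> integrable (scale_measure (ennreal c) M) f"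
    by (auto dest!: borel_measurable_integrable cong: measurable_cong_sets)
  then show ?thesis by (simp add: not_integrable_integral_eq)
qed

text \<open>A continuous function is bounded on compact \<open>Y\<close>, and the measure is finite.
  Closedness is assumed separately because compact sets in a general topological space need not be
  closed.\<close>

lemma set_integrable_measures_on:
  fixes g :: "'b::topological_space \<Rightarrow> real"
  assumes "compact Y" "closed Y" "continuous_on Y g" and \<mu>: "\<mu> \<in> measures_on Y"
  shows "set_integrable \<mu> Y g"
proof -
  interpret finite_measure \<mu> using measures_onD[OF \<mu>] by simp
  have [simp]: "sets \<mu> = sets borel" using measures_onD[OF \<mu>] by simp
  obtain B where B: "\<And>y. y \<in> Y \<Longrightarrow> \<bar>g y\<bar> \<le> B"
    using compact_imp_bounded[OF compact_continuous_image[OF assms(3,1)]]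
    by (auto simp: bounded_iff)
  have "(\<lambda>y. indicator Y y *\<^sub>R g y) \<in> borel_measurable \<mu>"
    using borel_measurable_continuous_on_indicator[of Y g] assms
    by (simp cong: measurable_cong_sets)
  then show ?thesis
    unfolding set_integrable_def
    by (rule integrable_const_bound[where B="\<bar>B\<bar>", rotated])
      (use B in \<open>force simp: indicator_def intro!: AE_I2\<close>)
qed

section \<open>Conjugate epigraphs and the convex cones formed by their unions\<close>

lemma mem_epi_conjugate: "(\<xi>, r) \<in> epi (conjugate \<phi>) \<longleftrightarrow> (\<forall>x. \<xi> \<bullet> x \<le> \<phi> x + r)"
  by (auto simp: epi_def conjugate_def SUP_le_iff algebra_simps)

text \<open>A point \<open>(\<xi>, r)\<close> of a conjugate epigraph is an affine minorant with
  slope \<open>\<xi>\<close> and constant term \<open>- r\<close>. Sums and nonnegative multiples of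
  minorants are minorants of the sums and multiples, so closure of the family \<open>L\<close>
  passes to the union.\<close>

lemma convex_cone_UN_epi_conjugate:
  assumes "I \<noteq> {}"
    and add: "\<And>i j. i \<in> I \<Longrightarrow> j \<in> I \<Longrightarrow> \<exists>k\<in>I. \<forall>x. L k x = L i x + L j x"
    and scale: "\<And>i c. i \<in> I \<Longrightarrow> 0 \<le> c \<Longrightarrow> \<exists>k\<in>I. \<forall>x. L k x = c * L i x"
  shows "convex_cone (\<Union>i\<in>I. epi (conjugate (L i)))" (is "convex_cone ?C")
proof -
  have "u + v \<in> ?C" if uv: "u \<in> ?C" "v \<in> ?C" for u v
  proof -
    obtain i j where ij: "i \<in> I" "j \<in> I" "u \<in> epi (conjugate (L i))" "v \<in> epi (conjugate (L j))"
      using uv by auto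
    obtain k where k: "k \<in> I" "\<And>x. L k x = L i x + L j x" using add[OF ij(1,2)] by auto
    obtain a r b t where [simp]: "u = (a, r)" "v = (b, t)" by fastforce
    have "a \<bullet> x + b \<bullet> x \<le> (L i x + r) + (L j x + t)" for x
      using ij(3,4) by (intro add_mono) (simp_all add: mem_epi_conjugate)
    then have "u + v \<in> epi (conjugate (L k))"
      by (simp add: mem_epi_conjugate inner_add_left k ac_simps)
    with k show ?thesis by auto
  qed
  moreover have "c *\<^sub>R u \<in> ?C" if u: "u \<in> ?C" and c: "0 \<le> c" for u c
  proof -
    obtain i where i: "i \<in> I" "u \<in> epi (conjugate (L i))" using u by auto
    obtain k where k: "k \<in> I" "\<And>x. L k x = c * L i x" using scale[OF i(1) c] by auto
    obtain a r where [simp]: "u = (a, r)" by fastforce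
    have "c * (a \<bullet> x) \<le> c * (L i x + r)" for x
      using i(2) c by (intro mult_left_mono) (simp_all add: mem_epi_conjugate)
    then have "c *\<^sub>R u \<in> epi (conjugate (L k))"
      by (simp add: mem_epi_conjugate k distrib_left)
    with k show ?thesis by auto
  qed
  moreover obtain i where "i \<in> I" using \<open>I \<noteq> {}\<close> by auto
  \<comment> \<open>Scaling by 0 produces an index with the zero function, whence the cone contains
    the origin.\<close>
  then obtain k where "k \<in> I" "\<And>x. L k x = 0" using scale[of i 0] by auto
  then have "(0, 0) \<in> epi (conjugate (L k))" by (simp add: mem_epi_conjugate)
  with \<open>k \<in> I\<close> have "(0, 0) \<in> ?C" by blast
  ultimately show ?thesis by (auto simp: convex_cone_iff zero_prod_def)
qed

lemma convex_cone_cone1: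
  fixes p :: "'a::real_inner \<Rightarrow> 'b::topological_space \<Rightarrow> real"
  assumes "compact Y" "closed Y" "\<And>x. continuous_on Y (p x)"
  shows "convex_cone (cone1 p Y)"
  unfolding cone1_def
proof (rule convex_cone_UN_epi_conjugate)
  show "measures_on Y \<noteq> {}" using null_measure_in_measures_on by blast
next
  fix \<mu> \<nu> assume \<mu>: "\<mu> \<in> measures_on Y" and \<nu>: "\<nu> \<in> measures_on Y"
  have "(LINT y:Y|sum_measure \<mu> \<nu>. p x y) = (LINT y:Y|\<mu>. p x y) + (LINT y:Y|\<nu>. p x y)" for x
    using set_integrable_measures_on[OF assms(1,2), of "p x"] assms(3) \<mu> \<nu>
      measures_onD(1)[OF \<mu>] measures_onD(1)[OF \<nu>]
    unfolding set_lebesgue_integral_def set_integrable_def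
    by (intro integral_sum_measure) simp_all
  then show "\<exists>\<kappa>\<in>measures_on Y. \<forall>x. (LINT y:Y|\<kappa>. p x y) = (LINT y:Y|\<mu>. p x y) + (LINT y:Y|\<nu>. p x y)"
    using sum_measure_in_measures_on[OF assms(2) \<mu> \<nu>] by blast
next
  fix \<mu> and c :: real assume "\<mu> \<in> measures_on Y" "0 \<le> c"
  then show "\<exists>\<kappa>\<in>measures_on Y. \<forall>x. (LINT y:Y|\<kappa>. p x y) = c * (LINT y:Y|\<mu>. p x y)"
    by (intro bexI[of _ "scale_measure (ennreal c) \<mu>"])
      (simp_all add: set_lebesgue_integral_def integral_scale_measure scale_measure_in_measures_on)
qed

lemma convex_cone_cone2: "convex_cone (cone2 s \<psi>)"
  unfolding cone2_def
proof (rule convex_cone_UN_epi_conjugate)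
  show "nonneg_orthant s \<noteq> {}" by (auto simp: nonneg_orthant_def intro!: exI[of _ "\<lambda>_. 0"])
next
  fix \<eta> \<theta> assume "\<eta> \<in> nonneg_orthant s" "\<theta> \<in> nonneg_orthant s"
  then show "\<exists>\<kappa>\<in>nonneg_orthant s. \<forall>x. (\<Sum>j=1..s. \<kappa> j * \<psi> j x) =
      (\<Sum>j=1..s. \<eta> j * \<psi> j x) + (\<Sum>j=1..s. \<theta> j * \<psi> j x)"
    by (intro bexI[of _ "\<lambda>j. \<eta> j + \<theta> j"])
      (auto simp: nonneg_orthant_def sum.distrib distrib_right Pi_iff)
next
  fix \<eta> and c :: real assume "\<eta> \<in> nonneg_orthant s" "0 \<le> c"
  then show "\<exists>\<kappa>\<in>nonneg_orthant s. \<forall>x. (\<Sum>j=1..s. \<kappa> j * \<psi> j x) = c * (\<Sum>j=1..s. \<eta> j * \<psi> j x)"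
    by (intro bexI[of _ "\<lambda>j. c * \<eta> j"])
      (auto simp: nonneg_orthant_def sum_distrib_left mult.assoc Pi_iff)
qed

section \<open>Separation: affine minorants and a Farkas lemma\<close>

text \<open>Since \<open>f\<close> is finite on the whole space, a hyperplane separating its strict
  epigraph from \<open>S \<times> {..r}\<close> cannot be vertical; dividing by its last coefficient
  \<open>w\<close> gives the affine function.\<close>

lemma convex_sandwich_affine:
  fixes f :: "'a::euclidean_space \<Rightarrow> real"
  assumes f: "convex_on UNIV f" and S: "convex S" "S \<noteq> {}" and r: "\<And>x. x \<in> S \<Longrightarrow> r \<le> f x"
  obtains a b where "\<And>x. b \<le> f x + a \<bullet> x" and "\<And>x. x \<in> S \<Longrightarrow> a \<bullet> x + r \<le> b"
proof -
  have "convex {(x, t). f x < t}"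
  proof (rule convexI)
    fix q q' :: "'a \<times> real" and u v :: real
    assume qq': "q \<in> {(x, t). f x < t}" "q' \<in> {(x, t). f x < t}"
      and uv: "0 \<le> u" "0 \<le> v" "u + v = 1"
    obtain x t y w where [simp]: "q = (x, t)" "q' = (y, w)" by (metis surj_pair)
    have H: "f x < t" "f y < w" "0 \<le> u" "0 \<le> v" "u + v = 1" using qq' uv by auto
    have "f (u *\<^sub>R x + v *\<^sub>R y) \<le> u * f x + v * f y"
      using f H by (simp add: convex_on_def)
    also have "\<dots> < u * t + v * w"
    \<comment> \<open>The strict inequality must come from a point of positive weight: the first
      one, or the second if \<open>u = 0\<close>.\<close>
    proof (cases "u = 0")
      case False
      then show ?thesis using H by (intro add_less_le_mono mult_left_mono) auto
    qed (use H in auto)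
    finally show "u *\<^sub>R q + v *\<^sub>R q' \<in> {(x, t). f x < t}" by simp
  qed
  moreover have "convex (S \<times> {..r})" using S by (intro convex_Times) auto
  moreover have "S \<times> {..r} \<noteq> {}" using S by auto
  moreover have "(0, f 0 + 1) \<in> {(x, t). f x < t}" by simp
  then have "{(x, t). f x < t} \<noteq> {}" by blast
  moreover have "S \<times> {..r} \<inter> {(x, t). f x < t} = {}" using r by fastforce
  ultimately obtain z b where z: "z \<noteq> 0"
      and lower: "\<forall>q\<in>S \<times> {..r}. z \<bullet> q \<le> b" and upper: "\<forall>q\<in>{(x, t). f x < t}. b \<le> z \<bullet> q"
    using separating_hyperplane_sets[of "S \<times> {..r}" "{(x, t). f x < t}"] by blast
  obtain a w where aw: "z = (a, w)" by fastforce
  have lower: "a \<bullet> x + w * r \<le> b" if "x \<in> S" for x using lower that by (auto simp: aw)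
  have upper: "b \<le> a \<bullet> x + w * t" if "f x < t" for x t using upper that by (auto simp: aw)
  obtain x0 where "x0 \<in> S" using S by auto
  \<comment> \<open>Two points above the same \<open>x0\<close>, one on each side of the hyperplane;
    as \<open>r < f x0 + 1\<close>, this fixes the sign of \<open>w\<close>.\<close>
  have "w * r \<le> w * (f x0 + 1)"
    using lower[OF \<open>x0 \<in> S\<close>] upper[of x0 "f x0 + 1"] by simp
  then have "0 \<le> w"
    using r[OF \<open>x0 \<in> S\<close>] by (smt (verit) mult_less_cancel_left)
  moreover have "w \<noteq> 0"
  proof
    assume "w = 0"
    then have "a \<noteq> 0" using z aw by (auto simp: zero_prod_def)
    have "b \<le> a \<bullet> x" for x using upper[of x "f x + 1"] \<open>w = 0\<close> by simp
    \<comment> \<open>A linear form bounded below on the whole space must vanish; this multiple of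
      \<open>a\<close> gives it the value \<open>- (\<bar>b\<bar> + 1)\<close>, which is below
      \<open>b\<close>.\<close>
    from this[of "- ((\<bar>b\<bar> + 1) / (a \<bullet> a)) *\<^sub>R a"] have "b \<le> - (\<bar>b\<bar> + 1)"
      using \<open>a \<noteq> 0\<close> by simp
    then show False by linarith
  qed
  ultimately have w: "0 < w" by simp
  show ?thesis
  proof
    fix x
    have "b / w - (a \<bullet> x) / w \<le> t" if "f x < t" for t
      using upper[OF that] w by (simp add: field_simps)
    then have "b / w - (a \<bullet> x) / w \<le> f x" by (rule dense_ge)
    then show "b / w \<le> f x + (a /\<^sub>R w) \<bullet> x" by (simp add: field_simps)
  next
    fix x assume "x \<in> S"
    from lower[OF this] w have "(a \<bullet> x + w * r) / w \<le> b / w" by (intro divide_right_mono) auto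
    with w have "a \<bullet> x / w + r \<le> b / w" by (simp add: add_divide_distrib)
    then show "(a /\<^sub>R w) \<bullet> x + r \<le> b / w" by (simp add: divide_inverse mult.commute)
  qed
qed

text \<open>With \<open>S = {v}\<close> and \<open>r = f v\<close> the sandwich lemma yields a
  subgradient: an affine minorant of \<open>f\<close>, exact at \<open>v\<close>. Its epigraph point
  \<open>(- a, - b)\<close> is the one to test.\<close>

lemma convex_nonpos_from_epi_conjugate:
  fixes f :: "'a::euclidean_space \<Rightarrow> real"
  assumes f: "convex_on UNIV f" and v: "\<And>\<xi> r. (\<xi>, r) \<in> epi (conjugate f) \<Longrightarrow> \<xi> \<bullet> v \<le> r"
  shows "f v \<le> 0"
proof -
  obtain a b where ab: "\<And>x. b \<le> f x + a \<bullet> x" "a \<bullet> v + f v \<le> b"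
    by (rule convex_sandwich_affine[OF f, of "{v}" "f v"]) auto
  have "- a \<bullet> x \<le> f x + (- b)" for x using ab(1)[of x] by simp
  then have "- a \<bullet> v \<le> - b" by (intro v) (simp add: mem_epi_conjugate)
  then show ?thesis using ab(2) by simp
qed

text \<open>The test vectors are normalised to the form \<open>(v, - 1)\<close>. Separation gives a
  functional \<open>(v, w)\<close> that is nonnegative on \<open>C\<close> and negative at
  \<open>(a, c)\<close>; \<open>one\<close> forces only \<open>0 \<le> w\<close>, and
  \<open>x0\<close> serves to repair the case \<open>w = 0\<close>.\<close>

lemma closed_convex_cone_Farkas:
  fixes C :: "('a::euclidean_space \<times> real) set"
  assumes C: "closed C" "convex_cone C" and one: "(0, 1) \<in> C"
    and x0: "\<And>\<xi> r. (\<xi>, r) \<in> C \<Longrightarrow> \<xi> \<bullet> x0 \<le> r"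
    and ac: "\<And>v. (\<And>\<xi> r. (\<xi>, r) \<in> C \<Longrightarrow> \<xi> \<bullet> v \<le> r) \<Longrightarrow> a \<bullet> v \<le> c"
  shows "(a, c) \<in> C"
proof (rule ccontr)
  assume "(a, c) \<notin> C"
  moreover have "convex C" using C(2) by (simp add: convex_cone_def)
  ultimately obtain z d where z: "z \<bullet> (a, c) < d" "\<And>q. q \<in> C \<Longrightarrow> d < z \<bullet> q"
    using separating_hyperplane_closed_point[of C "(a, c)"] C(1) by blast
  have "d < 0" using z(2)[OF convex_cone_contains_0[OF C(2)]] by simp
  have nonneg: "0 \<le> z \<bullet> q" if "q \<in> C" for q
  proof (rule ccontr)
    assume neg: "\<not> 0 \<le> z \<bullet> q"
    \<comment> \<open>This positive multiple of \<open>q\<close> has functional value exactly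
      \<open>d\<close>, contradicting strict separation.\<close>
    with \<open>d < 0\<close> have "(d / (z \<bullet> q)) *\<^sub>R q \<in> C"
      by (intro convex_cone_scaleR[OF C(2)] that) (simp add: zero_le_divide_iff)
    from z(2)[OF this] neg show False by simp
  qed
  obtain v w where vw: "z = (v, w)" by fastforce
  have "0 \<le> w" using nonneg[OF one] by (simp add: vw)
  have neg: "v \<bullet> a + w * c < 0" using z(1) \<open>d < 0\<close> by (simp add: vw)
  \<comment> \<open>Moving the separating functional slightly towards \<open>(- x0, 1)\<close> makes it non-vertical.\<close>
  have D: "0 \<le> c - a \<bullet> x0" using ac[OF x0] by simp
  \<comment> \<open>Small enough that \<open>(v, w) + e * (- x0, 1)\<close> stays negative at
    \<open>(a, c)\<close>; the summand 1 keeps the denominator positive when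
    \<open>c = a \<bullet> x0\<close>.\<close>
  define e where "e = - (v \<bullet> a + w * c) / (c - a \<bullet> x0 + 1)"
  have "0 < e" using neg D by (simp add: e_def)
  have "e * (c - a \<bullet> x0) < - (v \<bullet> a + w * c)"
  proof -
    have "e * (c - a \<bullet> x0) + e = - (v \<bullet> a + w * c)"
    proof -
      have "e * (c - a \<bullet> x0 + 1) = - (v \<bullet> a + w * c)" using D by (simp add: e_def)
      then show ?thesis by (simp add: algebra_simps)
    qed
    with \<open>0 < e\<close> show ?thesis by linarith
  qed
  have we: "0 < w + e" using \<open>0 \<le> w\<close> \<open>0 < e\<close> by simp
  \<comment> \<open>The perturbed functional is \<open>(v - e x0, w + e)\<close>. Dividing by its
    positive last coordinate and negating the first gives a point admissible in
    \<open>ac\<close>.\<close>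
  let ?u = "(e *\<^sub>R x0 - v) /\<^sub>R (w + e)"
  have u: "\<xi> \<bullet> ?u = (e * (\<xi> \<bullet> x0) - \<xi> \<bullet> v) / (w + e)" for \<xi>
    by (simp add: inner_diff_right divide_inverse mult.commute)
  have "\<xi> \<bullet> ?u \<le> r" if "(\<xi>, r) \<in> C" for \<xi> r
  proof -
    have "0 \<le> v \<bullet> \<xi> + w * r" using nonneg[OF that] by (simp add: vw)
    moreover have "e * (\<xi> \<bullet> x0) \<le> e * r" using x0[OF that] \<open>0 < e\<close> by simp
    ultimately have "e * (\<xi> \<bullet> x0) - \<xi> \<bullet> v \<le> (w + e) * r"
      by (simp add: inner_commute algebra_simps)
    then show ?thesis using we by (simp only: u pos_divide_le_eq mult.commute)
  qed
  then have "a \<bullet> ?u \<le> c" by (rule ac)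
  then have "e * (a \<bullet> x0) - a \<bullet> v \<le> (w + e) * c"
    using we by (simp only: u pos_divide_le_eq mult.commute)
  with \<open>e * (c - a \<bullet> x0) < - (v \<bullet> a + w * c)\<close> show False
    by (simp add: inner_commute algebra_simps)
qed

section \<open>Strong duality with attained multipliers\<close>

theorem theoremA2:
  fixes Y :: "(real ^ 'n) set"
    and h :: "real ^ 'm \<Rightarrow> real"
    and s :: nat
    and \<psi> :: "nat \<Rightarrow> real ^ 'm \<Rightarrow> real"
    and p :: "real ^ 'm \<Rightarrow> real ^ 'n \<Rightarrow> real"
  assumes "compact Y"
    and "continuous_on UNIV h" and "convex_on UNIV h"
    and "\<And>j. j \<in> {1..s} \<Longrightarrow> continuous_on UNIV (\<psi> j)"
    and "\<And>j. j \<in> {1..s} \<Longrightarrow> convex_on UNIV (\<psi> j)"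
    and "\<And>y. y \<in> Y \<Longrightarrow> continuous_on UNIV (\<lambda>x. p x y)"
    and "\<And>y. y \<in> Y \<Longrightarrow> convex_on UNIV (\<lambda>x. p x y)"
    and "lower_semicontinuous (\<lambda>(x, y). p x y)"
    and "\<And>x. continuous_on UNIV (p x)"
    and "feasible_set s \<psi> p Y \<noteq> {}"
    and "closed (cone1 p Y + cone2 s \<psi>)"
  shows "\<exists>\<mu>\<in>measures_on Y. \<exists>\<eta>\<in>nonneg_orthant s.
    (INF x\<in>feasible_set s \<psi> p Y. ereal (h x)) =
    (INF x. ereal (h x + (LINT y:Y|\<mu>. p x y) + (\<Sum>j=1..s. \<eta> j * \<psi> j x)))"
proof -
  let ?K = "feasible_set s \<psi> p Y"
  let ?P = "\<lambda>\<mu> x. LINT y:Y|\<mu>. p x y" and ?Q = "\<lambda>\<eta> x. \<Sum>j=1..s. \<eta> j * \<psi> j x"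
  let ?C = "cone1 p Y + cone2 s \<psi>"
  define r where "r = (INF x\<in>?K. ereal (h x))"
  have clY: "closed Y" using \<open>compact Y\<close> by (rule compact_imp_closed)
  have null: "?P (null_measure borel) x = 0" for x
    by (simp add: set_lebesgue_integral_def)
  have zero: "(\<lambda>_. 0) \<in> nonneg_orthant s" by (simp add: nonneg_orthant_def)
  have P_nonpos: "?P \<mu> x \<le> 0" if "x \<in> ?K" for \<mu> x
  proof -
    \<comment> \<open>Negating the integrand allows any \<open>\<mu>\<close>: a nonnegative function
      has a nonnegative integral even when it is not integrable, by the default value 0.\<close>
    have "0 \<le> (LINT y|\<mu>. - (indicator Y y *\<^sub>R p x y))"
      using that
      by (intro Bochner_Integration.integral_nonneg) (auto simp: indicator_def feasible_set_def)
    then show ?thesis by (simp add: set_lebesgue_integral_def)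
  qed
  have Q_nonpos: "?Q \<eta> x \<le> 0" if "x \<in> ?K" "\<eta> \<in> nonneg_orthant s" for \<eta> x
    using that
    by (intro sum_nonpos mult_nonneg_nonpos) (auto simp: feasible_set_def nonneg_orthant_def Pi_iff)
  \<comment> \<open>Weak duality: both multiplier terms are nonpositive on \<open>?K\<close>, and
    the left infimum ranges over more points.\<close>
  have weak: "(INF x. ereal (h x + ?P \<mu> x + ?Q \<eta> x)) \<le> r" if "\<eta> \<in> nonneg_orthant s" for \<mu> \<eta>
    unfolding r_def
  proof (rule INF_greatest)
    fix x assume "x \<in> ?K"
    have "h x + ?P \<mu> x + ?Q \<eta> x \<le> h x"
      using P_nonpos[OF \<open>x \<in> ?K\<close>, of \<mu>] Q_nonpos[OF \<open>x \<in> ?K\<close> that] by simp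
    then show "(INF x. ereal (h x + ?P \<mu> x + ?Q \<eta> x)) \<le> ereal (h x)"
      by (intro INF_lower2[of x]) auto
  qed
  have "r \<noteq> \<infinity>"
    using \<open>?K \<noteq> {}\<close> INF_lower[of _ ?K "\<lambda>x. ereal (h x)"] unfolding r_def by force
  then consider "r = - \<infinity>" | R where "r = ereal R" by (cases r) auto
  then show ?thesis
  proof cases
    case 1
    then have "r = (INF x. ereal (h x + ?P (null_measure borel) x + ?Q (\<lambda>_. 0) x))"
      using weak[OF zero, of "null_measure borel"] by simp
    then show ?thesis
      unfolding r_def by (intro bexI[OF _ null_measure_in_measures_on] bexI[OF _ zero])
  next
    case 2
    have "convex ?K"
    proof (rule convexI)
      fix x y and u v :: real
      assume H: "x \<in> ?K" "y \<in> ?K" "0 \<le> u" "0 \<le> v" "u + v = 1"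
      have "g (u *\<^sub>R x + v *\<^sub>R y) \<le> 0" if "convex_on UNIV g" "g x \<le> 0" "g y \<le> 0" for g
      proof -
        have "g (u *\<^sub>R x + v *\<^sub>R y) \<le> u * g x + v * g y"
          using that H by (simp add: convex_on_def)
        also have "\<dots> \<le> 0"
          using that H by (intro add_nonpos_nonpos mult_nonneg_nonpos)
        finally show ?thesis .
      qed
      then show "u *\<^sub>R x + v *\<^sub>R y \<in> ?K"
        using H(1,2) assms(5,7) unfolding feasible_set_def by blast
    qed
    moreover have "R \<le> h x" if "x \<in> ?K" for x
      using INF_lower[OF that, of "\<lambda>x. ereal (h x)"] 2 by (simp add: r_def)
    ultimately have hK: "convex ?K" "\<And>x. x \<in> ?K \<Longrightarrow> R \<le> h x" by blast+
    obtain a b where ab: "\<And>x. b \<le> h x + a \<bullet> x"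
        and abK: "\<And>x. x \<in> ?K \<Longrightarrow> a \<bullet> x + R \<le> b"
      by (rule convex_sandwich_affine[OF \<open>convex_on UNIV h\<close> hK(1) \<open>?K \<noteq> {}\<close> hK(2)]) (assumption, rule that)
    obtain x0 where x0: "x0 \<in> ?K" using \<open>?K \<noteq> {}\<close> by auto
    have C1: "convex_cone (cone1 p Y)"
      using assms(1,9) clY by (intro convex_cone_cone1) (auto intro: continuous_on_subset)
    have "(a, b - R) \<in> ?C"
    proof (rule closed_convex_cone_Farkas[where ?x0.0 = x0])
      show "closed ?C" by fact
      show "convex_cone ?C"
      proof -
        have "?C = (\<Union>x\<in>cone1 p Y. \<Union>y\<in>cone2 s \<psi>. {x + y})" by (auto simp: set_plus_def)
        then show ?thesis using convex_cone_sums[OF C1 convex_cone_cone2] by simp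
      qed
      \<comment> \<open>The zero measure gives the zero function, which lies above the constant
        -1.\<close>
      have "(0, 1) \<in> cone1 p Y"
        by (auto simp: cone1_def mem_epi_conjugate null intro!: bexI[OF _ null_measure_in_measures_on])
      from set_plus_intro[OF this convex_cone_contains_0[OF convex_cone_cone2]]
      show "(0, 1) \<in> ?C" by simp
    next
      fix \<xi> t assume "(\<xi>, t) \<in> ?C"
      then obtain \<xi>1 t1 \<xi>2 t2 where *: "\<xi> = \<xi>1 + \<xi>2" "t = t1 + t2"
          "(\<xi>1, t1) \<in> cone1 p Y" "(\<xi>2, t2) \<in> cone2 s \<psi>"
        by (auto elim!: set_plus_elim)
      have "\<xi>1 \<bullet> x0 \<le> t1"
      proof -
        obtain \<mu> where "\<xi>1 \<bullet> x0 \<le> ?P \<mu> x0 + t1"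
          using *(3) by (auto simp: cone1_def mem_epi_conjugate)
        with P_nonpos[OF x0, of \<mu>] show ?thesis by linarith
      qed
      moreover have "\<xi>2 \<bullet> x0 \<le> t2"
      proof -
        obtain \<eta> where "\<eta> \<in> nonneg_orthant s" "\<xi>2 \<bullet> x0 \<le> ?Q \<eta> x0 + t2"
          using *(4) by (auto simp: cone2_def mem_epi_conjugate)
        with Q_nonpos[OF x0, of \<eta>] show ?thesis by linarith
      qed
      ultimately show "\<xi> \<bullet> x0 \<le> t" by (simp add: * inner_add_left)
    next
      fix v assume v: "\<And>\<xi> t. (\<xi>, t) \<in> ?C \<Longrightarrow> \<xi> \<bullet> v \<le> t"
      \<comment> \<open>Each cone contains the origin, so both are contained in \<open>?C\<close>
        and can be tested separately.\<close>
      have v1: "\<xi> \<bullet> v \<le> t" if "(\<xi>, t) \<in> cone1 p Y" for \<xi> t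
        using v set_plus_intro[OF that convex_cone_contains_0[OF convex_cone_cone2]] by simp
      have v2: "\<xi> \<bullet> v \<le> t" if "(\<xi>, t) \<in> cone2 s \<psi>" for \<xi> t
        using v set_plus_intro[OF convex_cone_contains_0[OF C1] that] by simp
      have "v \<in> ?K"
        unfolding feasible_set_def
      proof (intro CollectI conjI ballI)
        fix j assume j: "j \<in> {1..s}"
        \<comment> \<open>A unit vector of multipliers isolates the constraint
          \<open>\<psi> j\<close>.\<close>
        let ?\<eta> = "\<lambda>i. if i = j then 1 else 0 :: real"
        have "?Q ?\<eta> x = \<psi> j x" for x
          using j by (simp add: if_distrib[of "\<lambda>z. z * _"] cong: if_cong)
        moreover have "?\<eta> \<in> nonneg_orthant s" by (simp add: nonneg_orthant_def)
        ultimately have "(\<xi>, t) \<in> cone2 s \<psi>" if "(\<xi>, t) \<in> epi (conjugate (\<psi> j))" for \<xi> t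
          using that unfolding cone2_def by (intro UN_I[of ?\<eta>]) simp_all
        then show "\<psi> j v \<le> 0"
          by (intro convex_nonpos_from_epi_conjugate[OF assms(5)[OF j]] v2)
      next
        fix y assume y: "y \<in> Y"
        \<comment> \<open>The Dirac measure at \<open>y\<close> isolates the constraint indexed by
          \<open>y\<close>.\<close>
        have "?P (return borel y) x = p x y" for x
        proof -
          have "(\<lambda>z. indicator Y z *\<^sub>R p x z) \<in> borel_measurable borel"
            using borel_measurable_continuous_on_indicator[of Y "p x"] clY
              continuous_on_subset[OF assms(9)] by auto
          then show ?thesis
            using y by (simp add: set_lebesgue_integral_def integral_return)
        qed
        then have "(\<xi>, t) \<in> cone1 p Y" if "(\<xi>, t) \<in> epi (conjugate (\<lambda>x. p x y))" for \<xi> t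
          using that return_in_measures_on[OF clY y] unfolding cone1_def
          by (intro UN_I[of "return borel y"]) simp_all
        then show "p v y \<le> 0"
          by (intro convex_nonpos_from_epi_conjugate[OF assms(7)[OF y]] v1)
      qed
      then show "a \<bullet> v \<le> b - R" using abK by fastforce
    qed
    then obtain \<xi>1 t1 \<xi>2 t2 where *: "a = \<xi>1 + \<xi>2" "b - R = t1 + t2"
        "(\<xi>1, t1) \<in> cone1 p Y" "(\<xi>2, t2) \<in> cone2 s \<psi>"
      by (auto elim!: set_plus_elim)
    obtain \<mu> where \<mu>: "\<mu> \<in> measures_on Y" "\<And>x. \<xi>1 \<bullet> x \<le> ?P \<mu> x + t1"
      using *(3) by (auto simp: cone1_def mem_epi_conjugate)
    obtain \<eta> where \<eta>: "\<eta> \<in> nonneg_orthant s" "\<And>x. \<xi>2 \<bullet> x \<le> ?Q \<eta> x + t2"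
      using *(4) by (auto simp: cone2_def mem_epi_conjugate)
    \<comment> \<open>Adding the two minorants bounds \<open>a \<bullet> x\<close> by the multiplier
      terms plus \<open>t1 + t2 = b - R\<close>; inserting this into \<open>ab\<close> cancels
      \<open>b\<close>.\<close>
    have "R \<le> h x + ?P \<mu> x + ?Q \<eta> x" for x
      using ab[of x] \<mu>(2)[of x] \<eta>(2)[of x] *(2) by (simp add: *(1) inner_add_left)
    then have "r \<le> (INF x. ereal (h x + ?P \<mu> x + ?Q \<eta> x))"
      unfolding 2 by (intro INF_greatest) simp
    with weak[OF \<eta>(1)] have "r = (INF x. ereal (h x + ?P \<mu> x + ?Q \<eta> x))"
      by (intro antisym)
    then show ?thesis
      unfolding r_def using \<mu>(1) \<eta>(1) by blast
  qed
qed

end
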